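(* Fix an integer $n\ge1$, a compact subset $K$ of the open simplex $\{\mathbf p\in\mathbb R^n: p_i>0,\ \sum_i p_i=1\}$, and a bound $B>0$. Then, for every fixed integer $r\ge1$, as $N\to\infty$, uniformly for $\mathbf p=(p_1,\dots,p_n)\in K$ and for integer points $m=(m_1,\dots,m_n)$ with $\sum_i m_i=N$ and $|t_i|\le B$ for all $i$, where $t_i:=m_i-Np_i$, $$\frac{N!}{m_1!\cdots m_n!}\prod_{i=1}^n p_i^{m_i}=\frac{1}{(2\pi N)^{(n-1)/2}(p_1\cdots p_n)^{1/2}}\Bigl(\sum_{j=0}^{r-1}\frac{Q_j}{N^j}+O(N^{-r})\Bigr),$$ where the implied constant depends only on $n,K,B,r$. Here $Q_0=1$ and $$Q_j=\frac{1}{j!}\,Y_j(1!\,c_1,2!\,c_2,\dots,j!\,c_j),\qquad c_k=\frac{(-1)^{k+1}}{k(k+1)}\Bigl[B_{k+1}-\sum_{i=1}^n p_i^{-k}B_{k+1}(t_i+1)\Bigr]\quad(k\ge1).$$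
   Context: The left-hand side is $\Pr\{X=m\}$ for $X$ multinomial with parameters $N$ and $\mathbf p$. $B_k(x)$ are the Bernoulli polynomials and $B_k=B_k(0)$ the Bernoulli numbers (with $B_1=-\tfrac12$). $Y_j$ denotes the $j$-th complete Bell polynomial, so that the $Q_j$ are determined by the formal power series identity $\exp\bigl(\sum_{k\ge1}c_kx^k\bigr)=\sum_{j\ge0}Q_jx^j$. The coefficients $c_k$ and $Q_j$ depend on $\mathbf p$ and $(t_1,\dots,t_n)$, hence may depend on $N$ through $m$. *)

theory Defs
  imports "HOL-Analysis.Analysis"
begin

(* t * exp(x t) / (exp t - 1) = (sum k. B_k(x) * t^k / k!); the quotient is a genuine power series
   because numerator and denominator have subdegree 1. *)
definition bernpoly :: "nat \<Rightarrow> real \<Rightarrow> real" where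
  "bernpoly k x = fact k * fps_nth (fps_X * fps_exp x / (fps_exp 1 - 1)) k"

lemma bernpoly_gf:
  "(fps_exp 1 - 1) * Abs_fps (\<lambda>k. bernpoly k x / fact k) = fps_X * fps_exp (x :: real)"
proof -
  have nz: "fps_exp 1 - 1 \<noteq> (0 :: real fps)"
    by (auto simp: fps_eq_iff intro!: exI[of _ 1])
  have sd: "subdegree (fps_exp 1 - 1 :: real fps) = 1"
    by (rule subdegreeI) auto
  have sd': "subdegree (fps_X * fps_exp x) = 1"
    by (rule subdegreeI) auto
  have dvd: "(fps_exp 1 - 1) dvd fps_X * fps_exp x"
    using nz sd sd' by (subst fps_dvd_iff) (auto simp: fps_eq_iff)
  have "Abs_fps (\<lambda>k. bernpoly k x / fact k) = fps_X * fps_exp x / (fps_exp 1 - 1)"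
    by (simp add: bernpoly_def fps_eq_iff)
  then show ?thesis
    using dvd by simp
qed

abbreviation bernoulli :: "nat \<Rightarrow> real" where
  "bernoulli k \<equiv> bernpoly k 0"

lemma bernoulli_1: "bernoulli 1 = - 1 / 2"
proof -
  have nth: "fps_nth ((fps_exp 1 - 1) * Abs_fps (\<lambda>k. bernpoly k 0 / fact k)) n = fps_nth fps_X n" for n
    using bernpoly_gf[of 0] by simp
  show ?thesis
    using nth[of 1] nth[of 2]
    by (simp add: fps_mult_nth numeral_2_eq_2)
qed

(* Complete Bell polynomial Y_j(x 1, ..., x j), given by
   exp (sum k\<ge>1. x k * t^k / k!) = (sum j. Y_j(x 1, ..., x j) * t^j / j!);
   the value does not depend on x 0 nor on x k for k > j. *)
definition complete_bell :: "nat \<Rightarrow> (nat \<Rightarrow> real) \<Rightarrow> real" where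
  "complete_bell j x =
     fact j * fps_nth (fps_exp 1 oo Abs_fps (\<lambda>k. if k = 0 then 0 else x k / fact k)) j"

lemma complete_bell_0: "complete_bell 0 x = 1"
  by (simp add: complete_bell_def)

lemma complete_bell_Suc:
  "complete_bell (Suc n) x = (\<Sum>i\<le>n. real (n choose i) * x (Suc i) * complete_bell (n - i) x)"
proof -
  define G where "G = Abs_fps (\<lambda>k. if k = 0 then 0 else x k / fact k)"
  define F where "F = (fps_exp 1 oo G)"
  have G0: "fps_nth G 0 = 0" by (simp add: G_def)
  have cb: "complete_bell k x = fact k * fps_nth F k" for k
    by (simp add: complete_bell_def F_def G_def)
  have "fps_deriv F = F * fps_deriv G"
    unfolding F_def by (subst fps_compose_deriv[OF G0]) simp
  then have "fps_nth (fps_deriv F) n = fps_nth (fps_deriv G * F) n"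
    by (simp add: mult.commute)
  then have "real (Suc n) * fps_nth F (Suc n)
      = (\<Sum>i\<le>n. real (Suc i) * fps_nth G (Suc i) * fps_nth F (n - i))"
    by (simp add: fps_mult_nth atMost_atLeast0)
  then have "complete_bell (Suc n) x
      = fact n * (\<Sum>i\<le>n. real (Suc i) * fps_nth G (Suc i) * fps_nth F (n - i))"
    by (simp only: cb fact_Suc of_nat_mult mult.assoc mult.left_commute[of "real (Suc n)"])
  also have "\<dots> = (\<Sum>i\<le>n. real (n choose i) * x (Suc i) * complete_bell (n - i) x)"
    unfolding sum_distrib_left
    by (rule sum.cong) (auto simp: cb G_def binomial_fact divide_simps)
  finally show ?thesis .
qed

definition c_coeff :: "real ^ 'n::finite \<Rightarrow> real ^ 'n \<Rightarrow> nat \<Rightarrow> real" where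
  "c_coeff p t k =
     (- 1) ^ (k + 1) / (real k * real (k + 1)) *
     (bernoulli (k + 1) - (\<Sum>i\<in>UNIV. bernpoly (k + 1) (t $ i + 1) / (p $ i) ^ k))"

definition Q_coeff :: "real ^ 'n::finite \<Rightarrow> real ^ 'n \<Rightarrow> nat \<Rightarrow> real" where
  "Q_coeff p t j = 1 / fact j * complete_bell j (\<lambda>k. fact k * c_coeff p t k)"

lemma Q_coeff_0: "Q_coeff p t 0 = 1"
  by (simp add: Q_coeff_def complete_bell_0)

lemma Q_coeff_gf:
  "fps_exp 1 oo Abs_fps (\<lambda>k. if k = 0 then 0 else c_coeff p t k) = Abs_fps (Q_coeff p t)"
  by (simp add: fps_eq_iff Q_coeff_def complete_bell_def cong: if_cong)

definition open_simplex :: "(real ^ 'n::finite) set" where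
  "open_simplex = {p. (\<forall>i. 0 < p $ i) \<and> (\<Sum>i\<in>UNIV. p $ i) = 1}"

end

theory Submission
  imports Defs
begin

text \<open>
  Write \<open>S r z a\<close> for the Stirling polynomial
  \<open>(z + a - 1/2) ln z - z + ln (2\<pi>) / 2 + (\<Sum>k=1..r. (-1)^(k+1) B_(k+1)(a) / (k (k+1) z^k))\<close>,
  the expected approximation of \<open>ln \<Gamma>(z + a)\<close>. Since \<open>B_(k+1)' = (k+1) B_k\<close>, the derivative of
  \<open>S r (z - s) (a + s)\<close> in \<open>s\<close> telescopes to a single term of order \<open>z^(-r-1)\<close>, so \<open>S\<close> depends only
  on \<open>z + a\<close> up to that order. Together with \<open>B_(k+1)(a + 1) - B_(k+1)(a) = (k+1) a^k\<close> this shows that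
  \<open>ln (m!) - S r m 1\<close> changes by \<open>O(m^(-r-1))\<close> from \<open>m\<close> to \<open>m + 1\<close>, hence converges at rate
  \<open>O(m^-r)\<close>; the limit is 0 by Wallis' product. Moving from \<open>S r m_i 1\<close> to \<open>S r (N p_i) (t_i + 1)\<close>
  costs no more, and summing over \<open>i\<close> gives the logarithm of the probability with the coefficients \<open>c_k\<close>.
  Exponentiating is controlled by the derivative of \<open>(\<Sum>j<r. Q_j x^j) exp (-\<Sum>k=1..r. c_k x^k)\<close>, in which all
  powers below \<open>x^(r-1)\<close> cancel.
\<close>

section \<open>Bernoulli polynomials\<close>

lemma fps_exp_minus_1_nonzero: "fps_exp 1 - 1 \<noteq> (0 :: real fps)"
  by (auto simp: fps_eq_iff intro!: exI[of _ 1])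

text \<open>Multiplied by \<open>fps_exp 1 - 1\<close>, both sides become
  \<open>fps_X * fps_exp (x + y)\<close> by \<open>bernpoly_gf\<close>; real power series have no
  zero divisors, so the factor can be cancelled.\<close>

lemma bernpoly_egf_translate:
  "Abs_fps (\<lambda>k. bernpoly k (x + y) / fact k) = Abs_fps (\<lambda>k. bernpoly k x / fact k) * fps_exp y"
proof -
  have "(fps_exp 1 - 1) * Abs_fps (\<lambda>k. bernpoly k (x + y) / fact k)
      = (fps_exp 1 - 1) * (Abs_fps (\<lambda>k. bernpoly k x / fact k) * fps_exp y)"
    by (simp only: bernpoly_gf mult.assoc[symmetric] fps_exp_add_mult)
  then show ?thesis
    using fps_exp_minus_1_nonzero by (simp only: mult_cancel_left) blast
qed

text \<open>Translation by 1 multiplies the generating function by \<open>fps_exp 1\<close>. The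
  difference is therefore \<open>fps_exp 1 - 1\<close> times the generating function, which is
  \<open>fps_X * fps_exp x\<close>.\<close>

lemma bernpoly_diff: "bernpoly (Suc k) (x + 1) - bernpoly (Suc k) x = real (Suc k) * x ^ k"
proof -
  let ?F = "Abs_fps (\<lambda>k. bernpoly k x / fact k)"
  have "Abs_fps (\<lambda>k. bernpoly k (x + 1) / fact k) - ?F = (fps_exp 1 - 1) * ?F"
    by (simp only: bernpoly_egf_translate[of x 1]) (simp add: algebra_simps)
  then have "fps_nth (Abs_fps (\<lambda>k. bernpoly k (x + 1) / fact k) - ?F) (Suc k)
      = fps_nth (fps_X * fps_exp x) (Suc k)"
    by (simp only: bernpoly_gf)
  then have "(bernpoly (Suc k) (x + 1) - bernpoly (Suc k) x) / fact (Suc k) = x ^ k / fact k"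
    by (simp add: diff_divide_distrib)
  then have "bernpoly (Suc k) (x + 1) - bernpoly (Suc k) x = x ^ k / fact k * fact (Suc k)"
    by (simp only: nonzero_divide_eq_eq[OF fact_nonzero])
  then show ?thesis
    by simp
qed

text \<open>The difference is \<open>k * 0 ^ (k - 1)\<close>, which vanishes only from
  \<open>k = 2\<close> on. This is what turns the correction terms of \<open>ln (N!)\<close> into
  Bernoulli numbers in \<open>c_coeff\<close>.\<close>

lemma bernpoly_at_1: "k \<ge> 2 \<Longrightarrow> bernpoly k 1 = bernoulli k"
  using bernpoly_diff[of "k - 1" 0] by (simp add: power_0_left)

text \<open>Translation from base point 0, read off coefficientwise. It shows that the coefficients
  of the series quotient are polynomials in \<open>x\<close>, so that they can be differentiated and
  bounded.\<close>

lemma bernpoly_expansion: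
  "bernpoly k x = fact k * (\<Sum>i\<le>k. bernoulli i / fact i * (x ^ (k - i) / fact (k - i)))"
proof -
  have "bernpoly k x / fact k = (\<Sum>i\<le>k. bernoulli i / fact i * (x ^ (k - i) / fact (k - i)))"
    using arg_cong[OF bernpoly_egf_translate[of 0 x], of "\<lambda>F. fps_nth F k"]
    by (simp add: fps_mult_nth atMost_atLeast0)
  then show ?thesis
    by (simp add: field_simps)
qed

lemma bernoulli_0: "bernoulli 0 = 1"
  using arg_cong[OF bernpoly_gf[of 0], of "\<lambda>F. fps_nth F 1"] by (simp add: fps_mult_nth)

lemma bernpoly_1: "bernpoly 1 x = x - 1 / 2"
  using bernoulli_1 by (simp add: bernpoly_expansion[of "Suc 0" x] bernoulli_0)

lemma has_real_derivative_bernpoly: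
  "(bernpoly (Suc k) has_real_derivative real (Suc k) * bernpoly k x) (at x)"
proof -
  have cancel: "real (Suc k - i) * y / fact (Suc k - i) = y / fact (k - i)" if "i \<le> k" for i y
    using that by (simp add: Suc_diff_le del: of_nat_Suc of_nat_diff)
  have "((\<lambda>x. fact (Suc k) * (\<Sum>i\<le>Suc k. bernoulli i / fact i * (x ^ (Suc k - i) / fact (Suc k - i))))
      has_real_derivative
      fact (Suc k) * (\<Sum>i\<le>Suc k. bernoulli i / fact i * (real (Suc k - i) * x ^ (Suc k - i - 1) / fact (Suc k - i))))
      (at x)"
    by (auto intro!: derivative_eq_intros sum.cong)
  also have "fact (Suc k) * (\<Sum>i\<le>Suc k. bernoulli i / fact i * (real (Suc k - i) * x ^ (Suc k - i - 1) / fact (Suc k - i)))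
     = fact (Suc k) * (\<Sum>i\<le>k. bernoulli i / fact i * (x ^ (k - i) / fact (k - i)))"
    by (simp add: cancel del: fact_Suc of_nat_diff of_nat_Suc
        times_divide_eq_left times_divide_eq_right times_divide_times_eq)
  also have "\<dots> = real (Suc k) * bernpoly k x"
    by (simp add: bernpoly_expansion[of k x] algebra_simps)
  finally show ?thesis
    by (simp only: bernpoly_expansion[of "Suc k", abs_def])
qed

lemma continuous_on_bernpoly: "continuous_on A (bernpoly k)"
  unfolding bernpoly_expansion[of k, abs_def] by (intro continuous_intros) auto

lemma bernpoly_bounded:
  obtains M where "M \<ge> 0" "\<And>k x. k \<le> n \<Longrightarrow> \<bar>x\<bar> \<le> A \<Longrightarrow> \<bar>bernpoly k x\<bar> \<le> M"
proof -
  have "\<exists>M. \<forall>x\<in>{-A..A}. \<bar>bernpoly k x\<bar> \<le> M" for k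
    using compact_imp_bounded[OF compact_continuous_image[OF continuous_on_bernpoly compact_Icc]]
    by (auto simp: bounded_iff)
  then obtain M where M: "\<And>k x. \<bar>x\<bar> \<le> A \<Longrightarrow> \<bar>bernpoly k x\<bar> \<le> M k"
    by (metis abs_le_iff atLeastAtMost_iff minus_le_iff)
  show ?thesis
  proof (rule that[of "\<Sum>k\<le>n. \<bar>M k\<bar>"])
    fix k x assume "k \<le> n" "\<bar>x\<bar> \<le> A"
    then have "\<bar>bernpoly k x\<bar> \<le> \<bar>M k\<bar>" using M[of x k] by linarith
    also have "\<dots> \<le> (\<Sum>k\<le>n. \<bar>M k\<bar>)"
      using \<open>k \<le> n\<close> by (intro member_le_sum) auto
    finally show "\<bar>bernpoly k x\<bar> \<le> (\<Sum>k\<le>n. \<bar>M k\<bar>)" .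
  qed (simp add: sum_nonneg)
qed

section \<open>Stirling's series\<close>

text \<open>This is \<open>S r z a\<close>. The argument \<open>z + a\<close> is kept in two pieces
  because \<open>m_i\<close> is split into the large part \<open>N p_i\<close> and the bounded part
  \<open>t_i\<close>.\<close>

definition stirling_approx :: "nat \<Rightarrow> real \<Rightarrow> real \<Rightarrow> real" where
  "stirling_approx r z a = (z + a - 1 / 2) * ln z - z + ln (2 * pi) / 2
     + (\<Sum>k=1..r. (- 1) ^ (k + 1) * bernpoly (k + 1) a / (real k * real (k + 1) * z ^ k))"

text \<open>Induction on \<open>r\<close>. The product rule applied to the new summand gives two
  terms: one cancels the previous remainder, the other is the next remainder.\<close>

lemma has_real_derivative_stirling_approx_shift:
  assumes "s < z"
  shows "((\<lambda>s. stirling_approx r (z - s) (a + s)) has_real_derivative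
     (- 1) ^ (r + 1) * bernpoly (r + 1) (a + s) / (real (r + 1) * (z - s) ^ (r + 1))) (at s)"
proof (induction r)
  case 0
  \<comment> \<open>The factor of the logarithm is constant in \<open>s\<close>, since
    \<open>(z - s) + (a + s) = z + a\<close>.\<close>
  have "((\<lambda>s. (z + a - 1 / 2) * ln (z - s) - (z - s) + ln (2 * pi) / 2) has_real_derivative
      (z + a - 1 / 2) * (- 1 / (z - s)) + 1) (at s)"
    using assms by (auto intro!: derivative_eq_intros)
  also have "(z + a - 1 / 2) * (- 1 / (z - s)) + 1 = - bernpoly 1 (a + s) / (z - s)"
    unfolding bernpoly_1 using assms by (simp add: divide_simps)
  finally show ?case
    by (simp add: stirling_approx_def)
next
  case (Suc r)
  let ?w = "z - s" and ?B = "\<lambda>k. bernpoly k (a + s)"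
  define b where "b = real (Suc r) * real (Suc (Suc r))"
  have b: "b \<noteq> 0" by (simp add: b_def del: of_nat_Suc)
  have w: "?w \<noteq> 0" using assms by simp
  have bern: "((\<lambda>s. bernpoly (Suc (Suc r)) (a + s)) has_real_derivative real (Suc (Suc r)) * ?B (Suc r)) (at s)"
    by (rule DERIV_cong[OF DERIV_chain2[where f = "bernpoly (Suc (Suc r))" and g = "\<lambda>s. a + s" and Db = 1,
          OF has_real_derivative_bernpoly]]) (auto intro!: derivative_eq_intros)
  have pw: "((\<lambda>s. inverse ((z - s) ^ Suc r)) has_real_derivative real (Suc r) / ?w ^ Suc (Suc r)) (at s)"
  proof (rule DERIV_cong)
    have "- (inverse (w * x) * - (c * x) * inverse (w * x)) = c / (w * (w * x))"
      if "w \<noteq> 0" "x \<noteq> 0" for c w x :: real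
      using that by (simp add: field_simps)
    from this[of ?w "?w ^ r" "real (Suc r)"] w
    show "- (inverse (?w ^ Suc r) * - (real (Suc r) * ?w ^ r) * inverse (?w ^ Suc r))
        = real (Suc r) / ?w ^ Suc (Suc r)"
      by (simp del: of_nat_Suc)
    have "((\<lambda>s. (z - s) ^ Suc r) has_real_derivative - (real (Suc r) * ?w ^ r)) (at s)"
      by (rule DERIV_cong[OF DERIV_chain2[where f = "\<lambda>x. x ^ Suc r" and g = "\<lambda>s. z - s" and Db = "- 1", OF DERIV_pow]])
        (auto intro!: derivative_eq_intros)
    then show "((\<lambda>s. inverse ((z - s) ^ Suc r)) has_real_derivative
        - (inverse (?w ^ Suc r) * - (real (Suc r) * ?w ^ r) * inverse (?w ^ Suc r))) (at s)"
      using w by (intro DERIV_inverse') auto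
  qed
  have "((\<lambda>s. (- 1) ^ (Suc r + 1) / b * (bernpoly (Suc (Suc r)) (a + s) * inverse ((z - s) ^ Suc r)))
      has_real_derivative
      (- 1) ^ (Suc r + 1) / b * (real (Suc (Suc r)) * ?B (Suc r) * inverse (?w ^ Suc r)
         + real (Suc r) / ?w ^ Suc (Suc r) * ?B (Suc (Suc r)))) (at s)"
    by (rule DERIV_cmult[OF DERIV_mult[OF bern pw]])
  from DERIV_add[OF Suc.IH this]
  have "((\<lambda>s. stirling_approx r (z - s) (a + s)
          + (- 1) ^ (Suc r + 1) / b * (bernpoly (Suc (Suc r)) (a + s) * inverse ((z - s) ^ Suc r)))
      has_real_derivative
      (- 1) ^ (r + 1) * ?B (r + 1) / (real (r + 1) * ?w ^ (r + 1))
      + (- 1) ^ (Suc r + 1) / b * (real (Suc (Suc r)) * ?B (Suc r) * inverse (?w ^ Suc r)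
         + real (Suc r) / ?w ^ Suc (Suc r) * ?B (Suc (Suc r)))) (at s)" .
  also have "(\<lambda>s. stirling_approx r (z - s) (a + s)
          + (- 1) ^ (Suc r + 1) / b * (bernpoly (Suc (Suc r)) (a + s) * inverse ((z - s) ^ Suc r)))
      = (\<lambda>s. stirling_approx (Suc r) (z - s) (a + s))"
  proof
    fix s
    have eq: "e / b * (x * inverse y) = e * x / (b * y)" for e x y :: real
      by (simp add: divide_inverse)
    show "stirling_approx r (z - s) (a + s)
          + (- 1) ^ (Suc r + 1) / b * (bernpoly (Suc (Suc r)) (a + s) * inverse ((z - s) ^ Suc r))
        = stirling_approx (Suc r) (z - s) (a + s)"
      unfolding eq by (simp add: stirling_approx_def b_def)
  qed
  also have "(- 1) ^ (r + 1) * ?B (r + 1) / (real (r + 1) * ?w ^ (r + 1))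
      + (- 1) ^ (Suc r + 1) / b * (real (Suc (Suc r)) * ?B (Suc r) * inverse (?w ^ Suc r)
         + real (Suc r) / ?w ^ Suc (Suc r) * ?B (Suc (Suc r)))
      = (- 1) ^ (Suc r + 1) * ?B (Suc r + 1) / (real (Suc r + 1) * ?w ^ (Suc r + 1))"
  proof -
    \<comment> \<open>Algebraic core of the telescoping: \<open>x\<close>, the value of degree
      \<open>r + 1\<close>, drops out, and only \<open>v\<close>, the value of degree
      \<open>r + 2\<close>, survives.\<close>
    have "e * x / (n * y) + - e / (n * l) * (l * x * inverse y + n / (w * y) * v) = - e * v / (l * (w * y))"
      if "n \<noteq> 0" "l \<noteq> 0" "y \<noteq> 0" "w \<noteq> 0" for e n l w x y v :: real
      using that by (simp add: field_simps)
    from this[of "real (Suc r)" "real (Suc (Suc r))" "?w ^ Suc r" ?w "(- 1) ^ (r + 1)"] w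
    show ?thesis
      by (simp add: b_def)
  qed
  finally show ?case .
qed

text \<open>Mean value inequality on the segment from 0 to \<open>t\<close>, where \<open>t\<close>
  may have either sign. As \<open>y\<close> lies below \<open>z - s\<close> at both ends, it does so
  all along the segment.\<close>

lemma stirling_approx_shift_bound:
  assumes M: "\<And>x. \<bar>x\<bar> \<le> \<bar>a\<bar> + \<bar>t\<bar> \<Longrightarrow> \<bar>bernpoly (r + 1) x\<bar> \<le> M"
    and y: "0 < y" "y \<le> z" "y \<le> z - t"
  shows "\<bar>stirling_approx r (z - t) (a + t) - stirling_approx r z a\<bar> \<le> \<bar>t\<bar> * M / y ^ (r + 1)"
proof -
  let ?f = "\<lambda>s. stirling_approx r (z - s) (a + s)"
  have "norm (?f t - ?f 0) \<le> M / y ^ (r + 1) * norm (t - 0)"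
  proof (rule field_differentiable_bound[of "closed_segment 0 t"])
    fix s assume "s \<in> closed_segment 0 t"
    then have s: "min 0 t \<le> s" "s \<le> max 0 t"
      by (auto simp: closed_segment_eq_real_ivl split: if_splits)
    then have sz: "y \<le> z - s" "\<bar>a + s\<bar> \<le> \<bar>a\<bar> + \<bar>t\<bar>" using y by auto
    show "(?f has_field_derivative
       (- 1) ^ (r + 1) * bernpoly (r + 1) (a + s) / (real (r + 1) * (z - s) ^ (r + 1)))
       (at s within closed_segment 0 t)"
      using sz y by (intro has_field_derivative_at_within[OF has_real_derivative_stirling_approx_shift]) auto
    have "\<bar>bernpoly (r + 1) (a + s)\<bar> / (real (r + 1) * (z - s) ^ (r + 1)) \<le> M / (1 * y ^ (r + 1))"
      using M[OF sz(2)] y sz by (intro frac_le mult_mono power_mono) (auto simp del: power_Suc)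
    then show "norm ((- 1) ^ (r + 1) * bernpoly (r + 1) (a + s) / (real (r + 1) * (z - s) ^ (r + 1)))
        \<le> M / y ^ (r + 1)"
      using sz y by (simp add: abs_mult power_abs)
  qed auto
  then show ?thesis by (simp add: mult.commute)
qed

text \<open>By \<open>bernpoly_diff\<close> the correction terms change by the Taylor polynomial of
  \<open>ln (1 + a / z)\<close>. This is an approximate form of the functional equation, as
  \<open>ln z + ln (1 + a / z) = ln (z + a)\<close>.\<close>

lemma stirling_approx_diff:
  assumes "z > 0"
  shows "stirling_approx r z (a + 1) - stirling_approx r z a
     = ln z - (\<Sum>k=1..r. (- (a / z)) ^ k / real k)"
proof -
  have "(\<Sum>k=1..r. (- 1) ^ (k + 1) * bernpoly (k + 1) (a + 1) / (real k * real (k + 1) * z ^ k))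
      - (\<Sum>k=1..r. (- 1) ^ (k + 1) * bernpoly (k + 1) a / (real k * real (k + 1) * z ^ k))
      = (\<Sum>k=1..r. (- 1) ^ (k + 1) * (bernpoly (k + 1) (a + 1) - bernpoly (k + 1) a) / (real k * real (k + 1) * z ^ k))"
    by (simp add: sum_subtractf[symmetric] right_diff_distrib diff_divide_distrib)
  also have "\<dots> = (\<Sum>k=1..r. - ((- (a / z)) ^ k / real k))"
  proof (rule sum.cong)
    fix k assume "k \<in> {1..r}"
    then show "(- 1) ^ (k + 1) * (bernpoly (k + 1) (a + 1) - bernpoly (k + 1) a) / (real k * real (k + 1) * z ^ k)
        = - ((- (a / z)) ^ k / real k)"
      using bernpoly_diff[of k a] assms power_minus[of "a / z" k]
      by (simp add: power_divide divide_simps del: of_nat_Suc)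
  qed simp
  finally show ?thesis
    by (simp add: stirling_approx_def sum_negf algebra_simps)
qed

text \<open>The derivative of the left-hand expression is \<open>1 / (1 + x)\<close> minus a finite
  geometric sum, that is \<open>(- x) ^ r / (1 + x)\<close>; the mean value inequality does the
  rest.\<close>

lemma ln_one_plus_taylor_bound:
  fixes u :: real
  assumes "u \<ge> 0"
  shows "\<bar>ln (1 + u) + (\<Sum>k=1..r. (- u) ^ k / real k)\<bar> \<le> u ^ (r + 1)"
proof -
  let ?f = "\<lambda>u. ln (1 + u) + (\<Sum>k=1..r. (- u) ^ k / real k)"
  have "norm (?f u - ?f 0) \<le> u ^ r * norm (u - 0)"
  proof (rule field_differentiable_bound[of "{0..u}"])
    fix x assume x: "x \<in> {0..u}"
    have "(?f has_field_derivative 1 / (1 + x) + (\<Sum>k=1..r. - ((- x) ^ (k - 1)))) (at x)"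
      using x by (auto intro!: derivative_eq_intros sum.cong)
    also have "(\<Sum>k=1..r. - ((- x) ^ (k - 1))) = - (\<Sum>k<r. (- x) ^ k)"
      by (simp add: sum.atLeast1_atMost_eq sum_negf)
    also have "1 / (1 + x) + - (\<Sum>k<r. (- x) ^ k) = (- x) ^ r / (1 + x)"
      using x power_diff_1_eq[of "- x" r] by (simp add: field_simps)
    finally show "(?f has_field_derivative (- x) ^ r / (1 + x)) (at x within {0..u})"
      by (rule has_field_derivative_at_within)
    have "x ^ r / (1 + x) \<le> u ^ r / 1"
      using x by (intro frac_le power_mono) auto
    then show "norm ((- x) ^ r / (1 + x)) \<le> u ^ r"
      using x by (simp add: power_abs)
  qed (use assms in auto)
  then show ?thesis using assms by (simp add: sum.neutral mult.commute power_0_left)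
qed

section \<open>The error of Stirling's series at factorials, and its decay\<close>

definition stirling_error :: "nat \<Rightarrow> nat \<Rightarrow> real" where
  "stirling_error r m = ln (fact m) - stirling_approx r (real m) 1"

text \<open>Up to order \<open>m ^ (- r - 1)\<close>, the approximation at \<open>(m + 1, 1)\<close>
  equals the one at \<open>(m, 2)\<close>, and the latter exceeds the one at \<open>(m, 1)\<close>
  by \<open>ln (m + 1)\<close>, exactly the increment of \<open>ln (fact m)\<close>.\<close>

lemma stirling_error_step:
  obtains C where "C \<ge> 0"
    "\<And>m. m \<ge> 1 \<Longrightarrow> \<bar>stirling_error r (Suc m) - stirling_error r m\<bar> \<le> C / real m ^ (r + 1)"
proof -
  obtain M where M: "M \<ge> 0" "\<And>k x. k \<le> r + 1 \<Longrightarrow> \<bar>x\<bar> \<le> 2 \<Longrightarrow> \<bar>bernpoly k x\<bar> \<le> M"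
    using bernpoly_bounded by blast
  show ?thesis
  proof (rule that[of "M + 1"])
    fix m :: nat assume m: "m \<ge> 1"
    let ?z = "real m" and ?e = "1 / real m ^ (r + 1)"
    have "\<bar>stirling_approx r ?z 2 - stirling_approx r (?z + 1) 1\<bar> \<le> M * ?e"
      using stirling_approx_shift_bound[of 1 1 r M "?z" "?z + 1"] M m by simp
    moreover have "stirling_approx r ?z 2 - stirling_approx r ?z 1
        = ln ?z - (\<Sum>k=1..r. (- (1 / ?z)) ^ k / real k)"
      using stirling_approx_diff[of ?z r 1] m by simp
    moreover have "\<bar>ln (1 + 1 / ?z) + (\<Sum>k=1..r. (- (1 / ?z)) ^ k / real k)\<bar> \<le> ?e"
      using ln_one_plus_taylor_bound[of "1 / ?z" r] by (simp add: power_divide)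
    moreover have "ln (1 + 1 / ?z) = ln (?z + 1) - ln ?z"
      using m ln_div[of "?z + 1" ?z] by (simp add: add_divide_distrib add.commute)
    moreover have "ln (fact (Suc m)) = ln (?z + 1) + ln (fact m)"
      using ln_mult[of "?z + 1" "fact m"] by (simp add: add.commute)
    ultimately have "\<bar>stirling_error r (Suc m) - stirling_error r m\<bar> \<le> M * ?e + ?e"
      by (simp add: stirling_error_def add.commute)
    then show "\<bar>stirling_error r (Suc m) - stirling_error r m\<bar> \<le> (M + 1) / real m ^ (r + 1)"
      by (simp add: add_divide_distrib)
  qed (use M in simp)
qed

text \<open>Expressing the partial Wallis products by factorials makes their logarithms accessible
  to the approximation of \<open>ln (fact n)\<close>.\<close>

lemma wallis_product_fact:
  "(\<Prod>k=1..n. 4 * (real k)\<^sup>2 / (4 * (real k)\<^sup>2 - 1))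
     = fact n ^ 4 * 2 ^ (4 * n) / ((fact (2 * n))\<^sup>2 * (2 * real n + 1))"
proof (induction n)
  case (Suc n)
  have f: "(fact (2 * Suc n) :: real) = 2 * real (Suc n) * ((2 * real n + 1) * fact (2 * n))"
    by (simp add: algebra_simps)
  have nz: "4 * (real (Suc n))\<^sup>2 - 1 = (2 * real n + 1) * (2 * real n + 3)"
    by (simp add: power2_eq_square algebra_simps)
  have "(\<Prod>k=1..Suc n. 4 * (real k)\<^sup>2 / (4 * (real k)\<^sup>2 - 1))
      = (\<Prod>k=1..n. 4 * (real k)\<^sup>2 / (4 * (real k)\<^sup>2 - 1))
        * (4 * (real (Suc n))\<^sup>2 / (4 * (real (Suc n))\<^sup>2 - 1))"
    by simp
  also have "\<dots> = fact n ^ 4 * 2 ^ (4 * n) / ((fact (2 * n))\<^sup>2 * (2 * real n + 1))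
        * (4 * (real (Suc n))\<^sup>2 / ((2 * real n + 1) * (2 * real n + 3)))"
    unfolding Suc.IH nz ..
  also have "\<dots> = real (Suc n) ^ 4 * fact n ^ 4 * (16 * 2 ^ (4 * n))
      / ((2 * real (Suc n) * ((2 * real n + 1) * fact (2 * n)))\<^sup>2 * (2 * real n + 3))"
  proof -
    have "x * w / (y * b) * (4 * a\<^sup>2 / (b * c)) = a ^ 4 * x * (16 * w) / ((2 * a)\<^sup>2 * (b\<^sup>2 * y) * c)"
      if "a \<noteq> 0" for a b c x y w :: real
      using that by (simp add: divide_simps power2_eq_square power4_eq_xxxx)
    from this[of "real (Suc n)" "fact n ^ 4" "2 ^ (4 * n)" "(fact (2 * n))\<^sup>2" "2 * real n + 1" "2 * real n + 3"]
    show ?thesis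
      by (simp add: power_mult_distrib mult.assoc del: of_nat_Suc)
  qed
  also have "\<dots> = fact (Suc n) ^ 4 * 2 ^ (4 * Suc n) / ((fact (2 * Suc n))\<^sup>2 * (2 * real (Suc n) + 1))"
  proof -
    have eqs: "2 * real (Suc n) + 1 = 2 * real n + 3" "(2 :: real) ^ (4 * Suc n) = 16 * 2 ^ (4 * n)"
      "fact (Suc n) ^ 4 = real (Suc n) ^ 4 * fact n ^ 4"
      by (simp_all add: power_mult_distrib power_add)
    show ?thesis unfolding f eqs ..
  qed
  finally show ?case .
qed simp

text \<open>For \<open>r \<ge> 1\<close> the increments are summable, so a limit \<open>L\<close>
  exists. In the logarithm of Wallis' product the error enters as \<open>4 * L - 2 * L\<close>, and
  the remaining constants already add up to \<open>ln (pi / 2)\<close>; hence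
  \<open>L = 0\<close>.\<close>

lemma stirling_error_tendsto_0:
  assumes "r \<ge> 1"
  shows "stirling_error r \<longlonglongrightarrow> 0"
proof -
  let ?D = "stirling_error r"
  obtain C where C: "C \<ge> 0" "\<And>m. m \<ge> 1 \<Longrightarrow> \<bar>?D (Suc m) - ?D m\<bar> \<le> C / real m ^ (r + 1)"
    using stirling_error_step by blast
  \<comment> \<open>The bound on increments starts at index 1. At 0 the error is a conventional
    value resting on \<open>ln 0 = 0\<close> and \<open>x / 0 = 0\<close>; a single term does not
    affect convergence.\<close>
  have "summable (\<lambda>m. ?D (Suc m) - ?D m)"
  proof (rule summable_comparison_test'[of _ 1])
    show "summable (\<lambda>m. C * inverse (real m ^ (r + 1)))"
      using assms by (intro summable_mult inverse_power_summable) auto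
  qed (use C in \<open>auto simp: divide_inverse\<close>)
  then have "convergent (\<lambda>n. (?D n - ?D 0) + ?D 0)"
    by (intro convergent_add) (auto simp: summable_iff_convergent sum_lessThan_telescope convergent_const)
  then obtain L where L: "?D \<longlonglongrightarrow> L" by (auto simp: convergent_def)
  define T where "T = (\<lambda>n. \<Sum>k=1..r. (- 1) ^ (k + 1) * bernpoly (k + 1) 1 / (real k * real (k + 1) * real n ^ k))"
  have T: "T \<longlonglongrightarrow> 0"
    unfolding T_def
  proof (rule tendsto_null_sum)
    fix k assume k: "k \<in> {1..r}"
    have "(\<lambda>n. (- 1) ^ (k + 1) * bernpoly (k + 1) 1 / (real k * real (k + 1)) * inverse (real n) ^ k) \<longlonglongrightarrow> 0"
      using k by (intro tendsto_mult_right_zero tendsto_null_power lim_inverse_n) auto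
    then show "(\<lambda>n. (- 1) ^ (k + 1) * bernpoly (k + 1) 1 / (real k * real (k + 1) * real n ^ k)) \<longlonglongrightarrow> 0"
      by (simp add: divide_inverse power_inverse mult.assoc)
  qed
  have lnfact: "ln (fact n) = ?D n + (real n + 1 / 2) * ln (real n) - real n + ln (2 * pi) / 2 + T n" for n
    by (simp add: stirling_error_def stirling_approx_def T_def)
  let ?W = "\<lambda>n. \<Prod>k=1..n. 4 * (real k)\<^sup>2 / (4 * (real k)\<^sup>2 - 1)"
  have dbl: "filterlim (\<lambda>n. 2 * n) sequentially sequentially"
    by (intro filterlim_subseq) (simp add: strict_mono_def)
  have "(\<lambda>n. ln (?W n)) \<longlonglongrightarrow> ln (pi / 2)"
    by (intro tendsto_ln wallis) simp
  moreover have "(\<lambda>n. ln (?W n)) \<longlonglongrightarrow> 4 * (L + 0) - 2 * (L + 0) + (ln (2 * pi) - ln 2 - ln 2)"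
  proof (rule Lim_transform_eventually)
    show "(\<lambda>n. 4 * (?D n + T n) - 2 * (?D (2 * n) + T (2 * n)) + (ln (2 * pi) - ln 2 - ln (2 + inverse (real n))))
        \<longlonglongrightarrow> 4 * (L + 0) - 2 * (L + 0) + (ln (2 * pi) - ln 2 - ln 2)"
      using tendsto_ln[OF tendsto_add[OF tendsto_const[of 2] lim_inverse_n]]
      by (intro tendsto_add tendsto_diff tendsto_mult tendsto_const L T
          filterlim_compose[OF L dbl] filterlim_compose[OF T dbl]) simp
    show "\<forall>\<^sub>F n in sequentially. 4 * (?D n + T n) - 2 * (?D (2 * n) + T (2 * n))
        + (ln (2 * pi) - ln 2 - ln (2 + inverse (real n))) = ln (?W n)"
      using eventually_gt_at_top[of 0]
    proof eventually_elim
      case (elim n)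
      have "ln (?W n) = 4 * ln (fact n) + real (4 * n) * ln 2 - (2 * ln (fact (2 * n)) + ln (2 * real n + 1))"
        unfolding wallis_product_fact
        by (simp add: ln_div ln_mult ln_realpow add_pos_nonneg del: of_nat_mult)
      \<comment> \<open>Splitting off \<open>ln n\<close> lets the divergent logarithms cancel and
        leaves a factor that tends to 2.\<close>
      moreover have "2 * real n + 1 = real n * (2 + inverse (real n))"
        using elim by (simp add: field_simps)
      then have "ln (2 * real n + 1) = ln (real n) + ln (2 + inverse (real n))"
        using elim ln_mult_pos[of "real n" "2 + inverse (real n)"] by (simp add: add_pos_nonneg)
      moreover have "ln (real (2 * n)) = ln 2 + ln (real n)"
        using elim by (simp add: ln_mult)
      ultimately show ?case
        unfolding lnfact by (simp add: algebra_simps)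
    qed
  qed
  ultimately have "ln (pi / 2) = 4 * (L + 0) - 2 * (L + 0) + (ln (2 * pi) - ln 2 - ln 2)"
    by (rule LIMSEQ_unique)
  then have "L = 0" by (simp add: ln_div ln_mult)
  then show ?thesis using L by simp
qed

text \<open>The error at \<open>m\<close> is minus the sum of all later increments, and the tail of
  \<open>C / n ^ (r + 1)\<close> from \<open>m\<close> on is of order
  \<open>m ^ (- r)\<close>.\<close>

lemma stirling_error_bound:
  assumes "r \<ge> 1"
  obtains C where "C \<ge> 0" "\<And>m. m \<ge> 1 \<Longrightarrow> \<bar>stirling_error r m\<bar> \<le> C / real m ^ r"
proof -
  let ?D = "stirling_error r"
  obtain C where C: "C \<ge> 0" "\<And>m. m \<ge> 1 \<Longrightarrow> \<bar>?D (Suc m) - ?D m\<bar> \<le> C / real m ^ (r + 1)"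
    using stirling_error_step by blast
  show ?thesis
  proof (rule that[of "2 * C"])
    fix m :: nat assume m: "m \<ge> 1"
    \<comment> \<open>For \<open>n \<ge> m\<close>, \<open>1 / n ^ (r + 1)\<close> is at most
      \<open>2 / m ^ (r - 1)\<close> times \<open>1 / (n * (n + 1))\<close>, which telescopes. The
      factor 2 comes from \<open>n + 1 \<le> 2 * n\<close>.\<close>
    have diff: "\<bar>?D n - ?D m\<bar> \<le> 2 * C / real m ^ (r - 1) * (1 / real m - 1 / real n)" if "n \<ge> m" for n
      using that
    proof (induction n rule: dec_induct)
      case (step n)
      have n: "n \<ge> 1" using m step by simp
      have le1: "real m ^ (r - 1) \<le> real n ^ (r - 1)"
        using step by (intro power_mono) auto
      have le2: "real n * (real n + 1) / 2 \<le> real n * real n"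
        using n by (simp add: field_simps)
      have "real m ^ (r - 1) * (real n * (real n + 1) / 2) \<le> real n ^ (r - 1) * (real n * real n)"
        by (rule mult_mono[OF le1 le2]) auto
      also have "\<dots> = real n ^ (r + 1)"
        using assms by (cases r) auto
      finally have "real m ^ (r - 1) * (real n * (real n + 1) / 2) \<le> real n ^ (r + 1)" .
      then have "C / real n ^ (r + 1) \<le> C / (real m ^ (r - 1) * (real n * (real n + 1) / 2))"
        using C m n by (intro divide_left_mono mult_pos_pos) auto
      also have "\<dots> = 2 * C / real m ^ (r - 1) * (1 / (real n * (real n + 1)))"
        by simp
      also have "1 / (real n * (real n + 1)) = 1 / real n - 1 / real (Suc n)"
        using n by (simp add: field_simps)
      finally have "\<bar>?D (Suc n) - ?D n\<bar> \<le> 2 * C / real m ^ (r - 1) * (1 / real n - 1 / real (Suc n))"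
        using C(2)[OF n] by linarith
      then show ?case using step.IH unfolding right_diff_distrib by linarith
    qed simp
    have "(\<lambda>n. ?D n - ?D m) \<longlonglongrightarrow> 0 - ?D m"
      by (intro tendsto_intros stirling_error_tendsto_0 assms)
    then have lim: "(\<lambda>n. \<bar>?D n - ?D m\<bar>) \<longlonglongrightarrow> \<bar>?D m\<bar>"
      by (auto dest: tendsto_rabs)
    have "\<bar>?D m\<bar> \<le> 2 * C / real m ^ (r - 1) * (1 / real m)"
    proof (rule LIMSEQ_le_const2[OF lim], intro exI[of _ m] allI impI)
      fix n assume "n \<ge> m"
      have "2 * C / real m ^ (r - 1) * (1 / real m - 1 / real n) \<le> 2 * C / real m ^ (r - 1) * (1 / real m)"
        using C by (intro mult_left_mono) auto
      then show "\<bar>?D n - ?D m\<bar> \<le> 2 * C / real m ^ (r - 1) * (1 / real m)"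
        using diff[OF \<open>n \<ge> m\<close>] by linarith
    qed
    also have "\<dots> = 2 * C / real m ^ r"
      using assms by (cases r) (auto simp: mult.commute)
    finally show "\<bar>?D m\<bar> \<le> 2 * C / real m ^ r" .
  qed (use C in simp)
qed

text \<open>The base point moves from \<open>m\<close> to \<open>z = m - t\<close> at the price of
  one shift, of the same order as the error at \<open>m\<close>. The constant is chosen before
  \<open>z\<close>, \<open>t\<close> and \<open>m\<close>.\<close>

lemma ln_fact_shifted_stirling:
  fixes A :: real
  assumes "r \<ge> 1" "A \<ge> 0"
  obtains C where "C \<ge> 0"
    "\<And>z t m. \<bar>t\<bar> \<le> A \<Longrightarrow> z \<ge> 2 * A + 2 \<Longrightarrow> z + t = real m \<Longrightarrow>
       \<bar>ln (fact m) - stirling_approx r z (t + 1)\<bar> \<le> C / z ^ r"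
proof -
  obtain C where C: "C \<ge> 0" "\<And>m. m \<ge> 1 \<Longrightarrow> \<bar>stirling_error r m\<bar> \<le> C / real m ^ r"
    using stirling_error_bound[OF assms(1)] by blast
  obtain M where M: "M \<ge> 0" "\<And>k x. k \<le> r + 1 \<Longrightarrow> \<bar>x\<bar> \<le> A + 1 \<Longrightarrow> \<bar>bernpoly k x\<bar> \<le> M"
    using bernpoly_bounded by blast
  show ?thesis
  proof (rule that[of "(C + A * M) * 2 ^ r"])
    fix z t :: real and m :: nat
    assume t: "\<bar>t\<bar> \<le> A" and z: "z \<ge> 2 * A + 2" and m: "z + t = real m"
    \<comment> \<open>The threshold on \<open>z\<close> makes \<open>z / 2\<close> a common lower
      bound of \<open>z\<close> and \<open>m\<close>, which is where \<open>2 ^ r\<close> comes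
      from; \<open>1 \<le> z / 2\<close> allows one power to be dropped later.\<close>
    have y: "1 \<le> z / 2" "z / 2 \<le> real m" "z / 2 \<le> z" using t z m assms by auto
    then have m1: "m \<ge> 1" by linarith
    have "\<bar>stirling_error r m\<bar> \<le> C / real m ^ r" using C m1 by simp
    also have "\<dots> \<le> C / (z / 2) ^ r"
      using C y by (intro divide_left_mono power_mono mult_pos_pos) auto
    finally have 1: "\<bar>stirling_error r m\<bar> \<le> C / (z / 2) ^ r" .
    have "\<bar>stirling_approx r (real m - t) (1 + t) - stirling_approx r (real m) 1\<bar>
        \<le> \<bar>t\<bar> * M / (z / 2) ^ (r + 1)"
      using t y m by (intro stirling_approx_shift_bound M) auto
    also have "\<dots> \<le> A * M / (z / 2) ^ r"
      using t y M by (intro frac_le mult_right_mono power_increasing) auto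
    finally have "\<bar>stirling_approx r (real m - t) (1 + t) - stirling_approx r (real m) 1\<bar> \<le> A * M / (z / 2) ^ r" .
    moreover have "stirling_approx r z (t + 1) = stirling_approx r (real m - t) (1 + t)"
      by (simp add: m[symmetric] add.commute)
    ultimately have "\<bar>ln (fact m) - stirling_approx r z (t + 1)\<bar> \<le> C / (z / 2) ^ r + A * M / (z / 2) ^ r"
      using 1 unfolding stirling_error_def by linarith
    then show "\<bar>ln (fact m) - stirling_approx r z (t + 1)\<bar> \<le> (C + A * M) * 2 ^ r / z ^ r"
      by (simp add: power_divide add_divide_distrib distrib_right)
  qed (use C M assms in auto)
qed

section \<open>Exponential of a polynomial\<close>

text \<open>The weights \<open>(i + 1) / (l + 1)\<close> are at most 1, so by induction
  \<open>Q (l + 1)\<close> is bounded by \<open>M\<close> times a geometric sum, which equals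
  \<open>(1 + M) ^ (l + 1) - 1\<close>.\<close>

lemma exp_recursion_bound:
  fixes c Q :: "nat \<Rightarrow> real"
  assumes Q0: "Q 0 = 1"
    and Q_Suc: "\<And>j. real (Suc j) * Q (Suc j) = (\<Sum>i\<le>j. real (Suc i) * c (Suc i) * Q (j - i))"
    and M: "M \<ge> 0" "\<And>k. 1 \<le> k \<Longrightarrow> k \<le> r \<Longrightarrow> \<bar>c k\<bar> \<le> M"
  shows "j \<le> r \<Longrightarrow> \<bar>Q j\<bar> \<le> (1 + M) ^ j"
proof (induction j rule: less_induct)
  case (less j)
  show ?case
  proof (cases j)
    case 0
    then show ?thesis by (simp add: Q0)
  next
    case (Suc l)
    have "real (Suc l) * \<bar>Q (Suc l)\<bar> = \<bar>\<Sum>i\<le>l. real (Suc i) * c (Suc i) * Q (l - i)\<bar>"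
      by (simp only: Q_Suc[symmetric] abs_mult abs_of_nat)
    also have "\<dots> \<le> (\<Sum>i\<le>l. real (Suc l) * (M * (1 + M) ^ (l - i)))"
    proof (rule order.trans[OF sum_abs], rule sum_mono)
      fix i assume "i \<in> {..l}"
      then have "\<bar>c (Suc i)\<bar> \<le> M" "\<bar>Q (l - i)\<bar> \<le> (1 + M) ^ (l - i)"
        using less Suc M by auto
      then show "\<bar>real (Suc i) * c (Suc i) * Q (l - i)\<bar> \<le> real (Suc l) * (M * (1 + M) ^ (l - i))"
        using \<open>i \<in> {..l}\<close> M(1) unfolding abs_mult mult.assoc abs_of_nat
        by (intro mult_mono) auto
    qed
    also have "\<dots> = real (Suc l) * (M * (\<Sum>i\<le>l. (1 + M) ^ (l - i)))"
      by (simp add: sum_distrib_left)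
    also have "(\<Sum>i\<le>l. (1 + M) ^ (l - i)) = (\<Sum>i<Suc l. (1 + M) ^ i)"
      using sum.nat_diff_reindex[of "\<lambda>i. (1 + M) ^ i" "Suc l"] by (simp add: lessThan_Suc_atMost)
    also have "M * \<dots> \<le> (1 + M) ^ Suc l"
      using power_diff_1_eq[of "1 + M" "Suc l"] by simp
    finally show ?thesis
      using Suc by (simp add: mult_le_cancel_left del: power_Suc)
  qed
qed

text \<open>\<open>C\<close> depends on \<open>M\<close> and \<open>r\<close> only and is fixed
  before \<open>c\<close>, \<open>Q\<close> and \<open>x\<close>: this carries the uniformity in
  \<open>p\<close> and \<open>m\<close>. The recursion is the identity \<open>F' = F G'\<close> for
  \<open>F = exp G\<close>, read off coefficientwise.\<close>

lemma exp_poly_expansion: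
  fixes M :: real
  assumes "M \<ge> 0" "r \<ge> 1"
  obtains C where "C \<ge> 0"
    "\<And>c Q x. \<lbrakk>Q 0 = 1; \<And>j. real (Suc j) * Q (Suc j) = (\<Sum>i\<le>j. real (Suc i) * c (Suc i) * Q (j - i));
       \<And>k. 1 \<le> k \<Longrightarrow> k \<le> r \<Longrightarrow> \<bar>c k\<bar> \<le> M; 0 \<le> x; x \<le> 1\<rbrakk>
     \<Longrightarrow> \<bar>exp (\<Sum>k=1..r. c k * x ^ k) - (\<Sum>j<r. Q j * x ^ j)\<bar> \<le> C * x ^ r"
proof -
  \<comment> \<open>\<open>D\<close> bounds the sum of the absolute coefficients of
    \<open>P * q'\<close>. In \<open>C\<close> one exponential bounds \<open>exp (- q)\<close>, the
    other \<open>exp q\<close>.\<close>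
  define D where "D = (\<Sum>i<r. \<Sum>k<r. (1 + M) ^ i * (real (Suc k) * M))"
  define C where "C = exp (real r * M) * (exp (real r * M) * D)"
  have D0: "D \<ge> 0" using assms by (auto simp: D_def intro!: sum_nonneg)
  then have C0: "C \<ge> 0" by (simp add: C_def)
  show ?thesis
  proof (rule that[OF C0])
    fix c Q :: "nat \<Rightarrow> real" and x :: real
    assume Q0: "Q 0 = 1"
      and Q_Suc: "\<And>j. real (Suc j) * Q (Suc j) = (\<Sum>i\<le>j. real (Suc i) * c (Suc i) * Q (j - i))"
      and c: "\<And>k. 1 \<le> k \<Longrightarrow> k \<le> r \<Longrightarrow> \<bar>c k\<bar> \<le> M" and x: "0 \<le> x" "x \<le> 1"
    define q where "q = (\<lambda>x. \<Sum>k=1..r. c k * x ^ k)"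
    define P where "P = (\<lambda>x. \<Sum>j<r. Q j * x ^ j)"
    define q' where "q' = (\<lambda>x. \<Sum>k<r. real (Suc k) * c (Suc k) * x ^ k)"
    define P' where "P' = (\<lambda>x. \<Sum>j<r-1. real (Suc j) * Q (Suc j) * x ^ j)"
    have q_alt: "q = (\<lambda>x. \<Sum>k<r. c (Suc k) * x ^ Suc k)"
      by (simp add: q_def sum.atLeast1_atMost_eq)
    have term_deriv: "((\<lambda>x. \<Sum>k<n. a k * x ^ Suc k) has_real_derivative (\<Sum>k<n. real (Suc k) * a k * y ^ k)) (at y)"
      for a :: "nat \<Rightarrow> real" and n y
    proof -
      have "((\<lambda>x. x ^ Suc k) has_real_derivative real (Suc k) * y ^ k) (at y)" for k
        using DERIV_pow[of "Suc k" y] by simp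
      then have "((\<lambda>x. \<Sum>k<n. a k * x ^ Suc k) has_real_derivative (\<Sum>k<n. a k * (real (Suc k) * y ^ k))) (at y)"
        by (intro DERIV_sum DERIV_cmult)
      then show ?thesis by (simp only: mult_ac)
    qed
    have dq: "(q has_real_derivative q' y) (at y)" for y
      unfolding q_alt q'_def by (rule term_deriv)
    obtain r' where r': "r = Suc r'" using assms(2) by (cases r) auto
    have P_alt: "P = (\<lambda>x. Q 0 + (\<Sum>j<r-1. Q (Suc j) * x ^ Suc j))"
      unfolding P_def r' by (simp add: sum.lessThan_Suc_shift del: sum.lessThan_Suc)
    have dP: "(P has_real_derivative P' y) (at y)" for y
      unfolding P_alt P'_def by (rule DERIV_cong[OF DERIV_add[OF DERIV_const term_deriv]]) simp
    have qb: "\<bar>q y\<bar> \<le> real r * M" if "0 \<le> y" "y \<le> 1" for y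
    proof -
      have "\<bar>q y\<bar> \<le> (\<Sum>k=1..r. \<bar>c k * y ^ k\<bar>)"
        unfolding q_def by (rule sum_abs)
      also have "\<dots> \<le> (\<Sum>k=1..r. M * 1)"
      proof (rule sum_mono)
        fix k assume "k \<in> {1..r}"
        then show "\<bar>c k * y ^ k\<bar> \<le> M * 1"
          unfolding abs_mult using c assms that by (intro mult_mono) (auto simp: power_le_one)
      qed
      finally show ?thesis by simp
    qed
    have prod: "P y * q' y = (\<Sum>(i, k)\<in>{..<r} \<times> {..<r}. Q i * (real (Suc k) * c (Suc k)) * y ^ (i + k))" for y
      unfolding P_def q'_def sum_product sum.cartesian_product
      by (rule sum.cong) (auto simp: power_add)
    \<comment> \<open>\<open>L\<close> holds the pairs contributing to degrees below
      \<open>r - 1\<close>; there \<open>P * q'\<close> agrees with \<open>P'\<close> by the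
      recursion. All other pairs contribute degree at least \<open>r - 1\<close>.\<close>
    define L where "L = {(i, k). i + k < r - 1}"
    have L: "L \<subseteq> {..<r} \<times> {..<r}" by (auto simp: L_def)
    have low: "(\<Sum>(i, k)\<in>L. Q i * (real (Suc k) * c (Suc k)) * y ^ (i + k)) = P' y" for y
    proof -
      have "(\<Sum>(i, k)\<in>L. Q i * (real (Suc k) * c (Suc k)) * y ^ (i + k))
          = (\<Sum>j<r-1. \<Sum>i\<le>j. Q i * (real (Suc (j - i)) * c (Suc (j - i))) * y ^ (i + (j - i)))"
        unfolding L_def by (rule sum.triangle_reindex)
      also have "\<dots> = (\<Sum>j<r-1. real (Suc j) * Q (Suc j) * y ^ j)"
      proof (rule sum.cong)
        fix j assume "j \<in> {..<r-1}"
        have "(\<Sum>i\<le>j. Q i * (real (Suc (j - i)) * c (Suc (j - i))) * y ^ (i + (j - i)))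
            = (\<Sum>i\<le>j. real (Suc (j - i)) * c (Suc (j - i)) * Q i) * y ^ j"
          unfolding sum_distrib_right by (rule sum.cong) auto
        also have "(\<Sum>i\<le>j. real (Suc (j - i)) * c (Suc (j - i)) * Q i)
            = (\<Sum>i\<le>j. real (Suc i) * c (Suc i) * Q (j - i))"
          by (rule sum.reindex_bij_witness[of _ "\<lambda>i. j - i" "\<lambda>i. j - i"]) auto
        finally show "(\<Sum>i\<le>j. Q i * (real (Suc (j - i)) * c (Suc (j - i))) * y ^ (i + (j - i)))
            = real (Suc j) * Q (Suc j) * y ^ j" by (simp only: Q_Suc)
      qed simp
      finally show ?thesis by (simp add: P'_def)
    qed
    have hi: "\<bar>P' y - P y * q' y\<bar> \<le> D * y ^ (r - 1)" if y: "0 \<le> y" "y \<le> 1" for y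
    proof -
      have "\<bar>P' y - P y * q' y\<bar> = \<bar>\<Sum>(i, k)\<in>{..<r} \<times> {..<r} - L. Q i * (real (Suc k) * c (Suc k)) * y ^ (i + k)\<bar>"
        unfolding prod low[symmetric] using L
        by (subst sum.subset_diff[of L "{..<r} \<times> {..<r}"]) auto
      also have "\<dots> \<le> (\<Sum>(i, k)\<in>{..<r} \<times> {..<r} - L. \<bar>Q i * (real (Suc k) * c (Suc k)) * y ^ (i + k)\<bar>)"
        unfolding split_def by (rule sum_abs)
      also have "\<dots> \<le> (\<Sum>(i, k)\<in>{..<r} \<times> {..<r} - L. ((1 + M) ^ i * (real (Suc k) * M)) * y ^ (r - 1))"
      proof (rule sum_mono)
        fix u assume "u \<in> {..<r} \<times> {..<r} - L"
        then obtain i k where u: "u = (i, k)" and ik: "(i, k) \<notin> L" "i < r" "k < r" by auto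
        have "\<bar>Q i\<bar> \<le> (1 + M) ^ i"
          using ik by (intro exp_recursion_bound[OF Q0 Q_Suc assms(1) c]) auto
        moreover have "\<bar>c (Suc k)\<bar> \<le> M" using c ik by auto
        moreover have "y ^ (i + k) \<le> y ^ (r - 1)"
          using ik y by (intro power_decreasing) (auto simp: L_def)
        ultimately show "(case u of (i, k) \<Rightarrow> \<bar>Q i * (real (Suc k) * c (Suc k)) * y ^ (i + k)\<bar>)
            \<le> (case u of (i, k) \<Rightarrow> ((1 + M) ^ i * (real (Suc k) * M)) * y ^ (r - 1))"
          using assms y unfolding u prod.case abs_mult abs_of_nat
          by (intro mult_mono) auto
      qed
      also have "\<dots> \<le> (\<Sum>(i, k)\<in>{..<r} \<times> {..<r}. ((1 + M) ^ i * (real (Suc k) * M)) * y ^ (r - 1))"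
        using assms y by (intro sum_mono2) auto
      also have "\<dots> = D * y ^ (r - 1)"
        by (simp add: D_def sum.cartesian_product sum_distrib_right split_def)
      finally show ?thesis .
    qed
    define h where "h = (\<lambda>y. P y * exp (- q y))"
    have dh: "(h has_real_derivative (P' y - P y * q' y) * exp (- q y)) (at y)" for y
      unfolding h_def by (auto intro!: derivative_eq_intros dP dq simp: algebra_simps)
    have h0: "h 0 = 1" by (simp add: h_def P_alt Q0 q_alt)
    have hb: "\<bar>h x - h 0\<bar> \<le> exp (real r * M) * D * x ^ r"
    proof -
      have "norm (h x - h 0) \<le> (D * x ^ (r - 1) * exp (real r * M)) * norm (x - 0)"
      proof (rule field_differentiable_bound[of "{0..x}"])
        fix y assume y: "y \<in> {0..x}"
        then have y': "0 \<le> y" "y \<le> 1" using x by auto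
        have "exp (- q y) \<le> exp (real r * M)" using qb[OF y'] by auto
        moreover have "D * y ^ (r - 1) \<le> D * x ^ (r - 1)"
          using D0 y by (intro mult_left_mono power_mono) auto
        ultimately show "norm ((P' y - P y * q' y) * exp (- q y)) \<le> D * x ^ (r - 1) * exp (real r * M)"
          using hi[OF y'] D0 x unfolding real_norm_def abs_mult by (intro mult_mono) auto
        show "(h has_field_derivative (P' y - P y * q' y) * exp (- q y)) (at y within {0..x})"
          using dh by (rule has_field_derivative_at_within)
      qed (use x in auto)
      then show ?thesis using x r' by (simp add: algebra_simps)
    qed
    have "exp (q x) - P x = exp (q x) * (h 0 - h x)"
      unfolding h0 by (simp add: h_def right_diff_distrib exp_minus field_simps)
    then have "\<bar>exp (q x) - P x\<bar> = exp (q x) * \<bar>h x - h 0\<bar>"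
      by (simp add: abs_mult abs_minus_commute)
    also have "\<dots> \<le> exp (real r * M) * (exp (real r * M) * D * x ^ r)"
      using qb[OF x] hb by (intro mult_mono) auto
    also have "\<dots> = C * x ^ r" by (simp add: C_def)
    finally show "\<bar>exp (\<Sum>k=1..r. c k * x ^ k) - (\<Sum>j<r. Q j * x ^ j)\<bar> \<le> C * x ^ r"
      by (simp add: q_def P_def)
  qed
qed

section \<open>Multinomial probabilities\<close>

text \<open>The Bell recursion after its binomials cancel against the factorials, in the form that
  \<open>exp_poly_expansion\<close> asks for.\<close>

lemma Q_coeff_Suc:
  "real (Suc j) * Q_coeff p t (Suc j) = (\<Sum>i\<le>j. real (Suc i) * c_coeff p t (Suc i) * Q_coeff p t (j - i))"
proof -
  let ?Y = "\<lambda>j. complete_bell j (\<lambda>k. fact k * c_coeff p t k)"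
  have "real (Suc j) * Q_coeff p t (Suc j) = ?Y (Suc j) / fact j"
    by (simp add: Q_coeff_def del: of_nat_Suc)
  also have "\<dots> = (\<Sum>i\<le>j. real (j choose i) * (fact (Suc i) * c_coeff p t (Suc i)) * ?Y (j - i) / fact j)"
    unfolding complete_bell_Suc sum_divide_distrib ..
  also have "\<dots> = (\<Sum>i\<le>j. real (Suc i) * c_coeff p t (Suc i) * Q_coeff p t (j - i))"
  proof (rule sum.cong)
    fix i assume "i \<in> {..j}"
    then have "real (j choose i) = fact j / (fact i * fact (j - i))"
      by (simp add: binomial_fact)
    then show "real (j choose i) * (fact (Suc i) * c_coeff p t (Suc i)) * ?Y (j - i) / fact j
        = real (Suc i) * c_coeff p t (Suc i) * Q_coeff p t (j - i)"
      by (simp add: Q_coeff_def del: of_nat_Suc)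
  qed simp
  finally show ?thesis .
qed

lemma c_coeff_bounded:
  assumes "\<delta> > 0"
  obtains M where "M \<ge> 0"
    "\<And>(p :: real ^ 'n::finite) t k. \<lbrakk>\<And>i. p $ i \<ge> \<delta>; \<And>i. \<bar>t $ i\<bar> \<le> B; 1 \<le> k; k \<le> r\<rbrakk> \<Longrightarrow> \<bar>c_coeff p t k\<bar> \<le> M"
proof -
  obtain M where M: "M \<ge> 0" "\<And>k x. k \<le> r + 1 \<Longrightarrow> \<bar>x\<bar> \<le> \<bar>B\<bar> + 1 \<Longrightarrow> \<bar>bernpoly k x\<bar> \<le> M"
    using bernpoly_bounded by blast
  \<comment> \<open>Capping at 1 makes powers of \<open>d\<close> decrease with the exponent, so
    \<open>d ^ r\<close> serves as lower bound for every \<open>k \<le> r\<close>.\<close>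
  define d where "d = min 1 \<delta>"
  have d: "0 < d" "d \<le> 1" "d \<le> \<delta>" using assms by (auto simp: d_def)
  show ?thesis
  proof (rule that[of "M + real CARD('n) * (M / d ^ r)"])
    fix p t :: "real ^ 'n" and k :: nat
    assume p: "\<And>i. p $ i \<ge> \<delta>" and t: "\<And>i. \<bar>t $ i\<bar> \<le> B" and k: "1 \<le> k" "k \<le> r"
    let ?S = "\<Sum>i\<in>UNIV. bernpoly (k + 1) (t $ i + 1) / (p $ i) ^ k"
    have "\<bar>bernpoly (k + 1) (t $ i + 1) / (p $ i) ^ k\<bar> \<le> M / d ^ r" for i
    proof -
      have "d ^ r \<le> d ^ k" using d k by (intro power_decreasing) auto
      also have "\<dots> \<le> (p $ i) ^ k" using d order.trans[OF d(3) p] by (intro power_mono) auto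
      finally have "d ^ r \<le> \<bar>p $ i ^ k\<bar>" by simp
      moreover have "\<bar>t $ i + 1\<bar> \<le> \<bar>B\<bar> + 1" using t[of i] by linarith
      then have "\<bar>bernpoly (k + 1) (t $ i + 1)\<bar> \<le> M" using k by (intro M) auto
      ultimately show ?thesis
        using d M unfolding abs_divide by (intro frac_le) auto
    qed
    then have "\<bar>?S\<bar> \<le> real CARD('n) * (M / d ^ r)"
      by (intro order.trans[OF sum_abs sum_bounded_above])
    moreover have "\<bar>bernoulli (k + 1)\<bar> \<le> M" using k by (intro M) auto
    ultimately have "\<bar>bernoulli (k + 1) - ?S\<bar> \<le> M + real CARD('n) * (M / d ^ r)"
      by linarith
    moreover have "\<bar>(- 1) ^ (k + 1) / (real k * real (k + 1))\<bar> \<le> 1"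
      using k mult_mono[of 1 "real k" 1 "real (k + 1)"] by (simp add: abs_mult power_abs)
    ultimately have "\<bar>c_coeff p t k\<bar> \<le> 1 * (M + real CARD('n) * (M / d ^ r))"
      unfolding c_coeff_def abs_mult[of "(- 1) ^ (k + 1) / (real k * real (k + 1))"] by (intro mult_mono) auto
    then show "\<bar>c_coeff p t k\<bar> \<le> M + real CARD('n) * (M / d ^ r)" by simp
  qed (use M d in simp)
qed

text \<open>Each coordinate attains a positive minimum on a nonempty compact \<open>K\<close>, and
  there are finitely many coordinates.\<close>

lemma compact_simplex_lower_bound:
  fixes K :: "(real ^ 'n::finite) set"
  assumes "compact K" "K \<subseteq> open_simplex"
  obtains \<delta> where "\<delta> > 0" "\<And>p i. p \<in> K \<Longrightarrow> \<delta> \<le> p $ i"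
proof -
  have "\<exists>d>0. \<forall>p\<in>K. d \<le> p $ i" for i
  proof (cases "K = {}")
    case False
    have "continuous_on K (\<lambda>p. p $ i)" by (intro continuous_intros)
    then obtain q where "q \<in> K" "\<forall>p\<in>K. q $ i \<le> p $ i"
      using continuous_attains_inf[OF assms(1) False] by blast
    then show ?thesis using assms(2) by (auto simp: open_simplex_def)
  qed (auto intro: exI[of _ 1])
  then obtain d where d: "\<And>i. d i > 0" "\<And>i p. p \<in> K \<Longrightarrow> d i \<le> p $ i" by metis
  show ?thesis
  proof (rule that[of "Min (range d)"])
    fix p i assume "p \<in> K"
    have "Min (range d) \<le> d i" by simp
    also have "\<dots> \<le> p $ i" using d \<open>p \<in> K\<close> by simp
    finally show "Min (range d) \<le> p $ i" .
  qed (use d in \<open>auto simp: Min_gr_iff\<close>)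
qed

text \<open>An exact identity: the correction terms add up to the \<open>c_coeff\<close> sum, the
  terms in \<open>N ln N\<close> and \<open>N\<close> cancel because the \<open>p_i\<close> sum to 1
  and the \<open>t_i\<close> to 0, and \<open>ln (2 * pi * N) / 2\<close> occurs once per coordinate
  against once for \<open>N!\<close>.\<close>

lemma stirling_approx_multinomial:
  fixes p t :: "real ^ 'n::finite" and N :: real
  assumes N: "N > 0" and p: "\<And>i. p $ i > 0" "(\<Sum>i\<in>UNIV. p $ i) = 1" and t: "(\<Sum>i\<in>UNIV. t $ i) = 0"
  shows "stirling_approx r N 1 - (\<Sum>i\<in>UNIV. stirling_approx r (N * p $ i) (t $ i + 1))
      + (\<Sum>i\<in>UNIV. (N * p $ i + t $ i) * ln (p $ i))
    = (\<Sum>k=1..r. c_coeff p t k * (1 / N) ^ k)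
      - (real CARD('n) - 1) / 2 * ln (2 * pi * N) - (\<Sum>i\<in>UNIV. ln (p $ i)) / 2"
proof -
  define G where "G = (\<lambda>z a :: real. (z + a - 1 / 2) * ln z - z + ln (2 * pi) / 2)"
  define T where "T = (\<lambda>z a. \<Sum>k=1..r. (- 1) ^ (k + 1) * bernpoly (k + 1) a / (real k * real (k + 1) * z ^ k))"
  have S: "stirling_approx r z a = G z a + T z a" for z a
    by (simp add: stirling_approx_def G_def T_def)
  have "T N 1 - (\<Sum>i\<in>UNIV. T (N * p $ i) (t $ i + 1)) = (\<Sum>k=1..r. c_coeff p t k * (1 / N) ^ k)"
    unfolding T_def
  proof (subst sum.swap, subst sum_subtractf[symmetric], rule sum.cong)
    fix k assume k: "k \<in> {1..r}"
    let ?a = "(- 1) ^ (k + 1) / (real k * real (k + 1))"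
    have "(\<Sum>i\<in>UNIV. (- 1) ^ (k + 1) * bernpoly (k + 1) (t $ i + 1) / (real k * real (k + 1) * (N * p $ i) ^ k))
        = ?a * (\<Sum>i\<in>UNIV. bernpoly (k + 1) (t $ i + 1) / (p $ i) ^ k) * (1 / N) ^ k"
      unfolding sum_distrib_left sum_distrib_right
      by (rule sum.cong) (simp_all add: power_mult_distrib power_divide)
    moreover have "bernpoly (k + 1) 1 = bernoulli (k + 1)"
      using k by (intro bernpoly_at_1) auto
    ultimately show "(- 1) ^ (k + 1) * bernpoly (k + 1) 1 / (real k * real (k + 1) * N ^ k)
        - (\<Sum>i\<in>UNIV. (- 1) ^ (k + 1) * bernpoly (k + 1) (t $ i + 1) / (real k * real (k + 1) * (N * p $ i) ^ k))
        = c_coeff p t k * (1 / N) ^ k"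
      unfolding c_coeff_def right_diff_distrib left_diff_distrib by (simp add: power_divide)
  qed simp
  moreover
  have "(\<Sum>i\<in>UNIV. G (N * p $ i) (t $ i + 1)) - (\<Sum>i\<in>UNIV. (N * p $ i + t $ i) * ln (p $ i))
      = (\<Sum>i\<in>UNIV. p $ i * (N * ln N - N) + t $ i * ln N + ln (p $ i) / 2 + (ln N + ln (2 * pi)) / 2)"
    unfolding sum_subtractf[symmetric] G_def
  proof (rule sum.cong)
    fix i
    have "ln (N * p $ i) = ln N + ln (p $ i)"
      using N p(1)[of i] by (simp add: ln_mult)
    then show "(N * p $ i + (t $ i + 1) - 1 / 2) * ln (N * p $ i) - N * p $ i + ln (2 * pi) / 2
        - (N * p $ i + t $ i) * ln (p $ i)
        = p $ i * (N * ln N - N) + t $ i * ln N + ln (p $ i) / 2 + (ln N + ln (2 * pi)) / 2"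
      by (simp add: algebra_simps add_divide_distrib)
  qed simp
  then have "(\<Sum>i\<in>UNIV. G (N * p $ i) (t $ i + 1)) - (\<Sum>i\<in>UNIV. (N * p $ i + t $ i) * ln (p $ i))
      = (N * ln N - N) + (\<Sum>i\<in>UNIV. ln (p $ i)) / 2 + real CARD('n) * ((ln N + ln (2 * pi)) / 2)"
    by (simp add: sum.distrib p t sum_distrib_right[symmetric] sum_divide_distrib[symmetric])
  moreover have "ln (2 * pi * N) = ln N + ln (2 * pi)"
    using N by (simp add: ln_mult)
  moreover have "G N 1 = N * ln N - N + (ln N + ln (2 * pi)) / 2"
    by (simp add: G_def algebra_simps add_divide_distrib)
  ultimately show ?thesis
    unfolding S sum.distrib by (simp add: algebra_simps add_divide_distrib diff_divide_distrib)
qed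

text \<open>\<open>E\<close> names the remainder, and \<open>C\<close> and \<open>N0\<close> are
  fixed before \<open>N\<close>, \<open>p\<close> and \<open>m\<close>, which expresses the
  uniformity. Once \<open>N \<ge> N0\<close>, the constraints force \<open>m_i \<ge> 0\<close>, so
  that \<open>nat\<close> loses nothing.\<close>

theorem theorem4p1:
  fixes K :: "(real ^ 'n::finite) set" and B :: real and r :: nat
  assumes "compact K" and "K \<subseteq> open_simplex" and "B > 0" and "r \<ge> 1"
  shows "\<exists>(E :: nat \<Rightarrow> real ^ 'n \<Rightarrow> int ^ 'n \<Rightarrow> real) (C :: real) (N0 :: nat).
    \<forall>N\<ge>N0. \<forall>p\<in>K. \<forall>m :: int ^ 'n.
      let t = (\<chi> i. of_int (m $ i) - real N * p $ i) :: real ^ 'n in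
      (\<Sum>i\<in>UNIV. m $ i) = int N \<and> (\<forall>i. \<bar>t $ i\<bar> \<le> B) \<longrightarrow>
        fact N / (\<Prod>i\<in>UNIV. fact (nat (m $ i))) * (\<Prod>i\<in>UNIV. (p $ i) powi (m $ i)) =
          1 / ((2 * pi * real N) powr ((real CARD('n) - 1) / 2) * sqrt (\<Prod>i\<in>UNIV. p $ i)) *
          ((\<Sum>j<r. Q_coeff p t j / real N ^ j) + E N p m) \<and>
        \<bar>E N p m\<bar> \<le> C / real N ^ r"
proof -
  obtain \<delta> where \<delta>: "\<delta> > 0" "\<And>p i. p \<in> K \<Longrightarrow> \<delta> \<le> p $ i"
    using compact_simplex_lower_bound[OF assms(1,2)] by blast
  obtain M where M: "M \<ge> 0"
    "\<And>(p :: real ^ 'n) t k. \<lbrakk>\<And>i. p $ i \<ge> \<delta>; \<And>i. \<bar>t $ i\<bar> \<le> B; 1 \<le> k; k \<le> r\<rbrakk> \<Longrightarrow> \<bar>c_coeff p t k\<bar> \<le> M"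
  proof (rule c_coeff_bounded[OF \<delta>(1)])
    fix M assume "M \<ge> 0" and *: "\<And>(p :: real ^ 'n) t k.
      \<lbrakk>\<And>i. p $ i \<ge> \<delta>; \<And>i. \<bar>t $ i\<bar> \<le> B; 1 \<le> k; k \<le> r\<rbrakk> \<Longrightarrow> \<bar>c_coeff p t k\<bar> \<le> M"
    show thesis by (rule that[of M]) fact+
  qed
  obtain C1 where C1: "C1 \<ge> 0"
    "\<And>z t m. \<bar>t\<bar> \<le> B \<Longrightarrow> z \<ge> 2 * B + 2 \<Longrightarrow> z + t = real m \<Longrightarrow>
       \<bar>ln (fact m) - stirling_approx r z (t + 1)\<bar> \<le> C1 / z ^ r"
  proof (rule ln_fact_shifted_stirling[OF assms(4) less_imp_le[OF assms(3)]])
    fix C assume "C \<ge> 0" and "\<And>z t m. \<bar>t\<bar> \<le> B \<Longrightarrow> z \<ge> 2 * B + 2 \<Longrightarrow> z + t = real m \<Longrightarrow>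
       \<bar>ln (fact m) - stirling_approx r z (t + 1)\<bar> \<le> C / z ^ r"
    show thesis by (rule that[of C]) fact+
  qed
  obtain C2 where C2: "C2 \<ge> 0"
    "\<And>c Q x. \<lbrakk>Q 0 = 1; \<And>j. real (Suc j) * Q (Suc j) = (\<Sum>i\<le>j. real (Suc i) * c (Suc i) * Q (j - i));
       \<And>k. 1 \<le> k \<Longrightarrow> k \<le> r \<Longrightarrow> \<bar>c k\<bar> \<le> M; 0 \<le> x; x \<le> 1\<rbrakk>
     \<Longrightarrow> \<bar>exp (\<Sum>k=1..r. c k * x ^ k) - (\<Sum>j<r. Q j * x ^ j)\<bar> \<le> C2 * x ^ r"
  proof (rule exp_poly_expansion[OF M(1) assms(4)])
    fix C assume "C \<ge> 0" and "\<And>c Q x. \<lbrakk>Q 0 = 1; \<And>j. real (Suc j) * Q (Suc j) = (\<Sum>i\<le>j. real (Suc i) * c (Suc i) * Q (j - i));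
       \<And>k. 1 \<le> k \<Longrightarrow> k \<le> r \<Longrightarrow> \<bar>c k\<bar> \<le> M; 0 \<le> x; x \<le> 1\<rbrakk>
     \<Longrightarrow> \<bar>exp (\<Sum>k=1..r. c k * x ^ k) - (\<Sum>j<r. Q j * x ^ j)\<bar> \<le> C * x ^ r"
    show thesis by (rule that[of C]) fact+
  qed
  \<comment> \<open>One Stirling error at \<open>N\<close> and one for each coordinate at
    \<open>N p_i\<close>, which is at least \<open>N \<delta>\<close>.\<close>
  define C3 where "C3 = C1 + real CARD('n) * (C1 / \<delta> ^ r)"
  have C3: "C3 \<ge> 0" using C1 \<delta> by (simp add: C3_def)
  \<comment> \<open>The first summand bounds \<open>exp q * (exp R - 1)\<close>, the second the
    truncation of \<open>exp q\<close>.\<close>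
  define C where "C = exp (real r * M) * (exp C3 * C3) + C2"
  \<comment> \<open>Large enough for both \<open>N\<close> and \<open>N \<delta>\<close> to reach
    \<open>2 * B + 2\<close>, the threshold of \<open>ln_fact_shifted_stirling\<close>.\<close>
  define N0 where "N0 = nat \<lceil>(2 * B + 2) / \<delta> + 2 * B + 2\<rceil>"
  define t where "t = (\<lambda>N (p :: real ^ 'n) (m :: int ^ 'n). (\<chi> i. of_int (m $ i) - real N * p $ i) :: real ^ 'n)"
  define pre where "pre = (\<lambda>N (p :: real ^ 'n). (2 * pi * real N) powr ((real CARD('n) - 1) / 2) * sqrt (\<Prod>i\<in>UNIV. p $ i))"
  define prob where "prob = (\<lambda>N (p :: real ^ 'n) (m :: int ^ 'n).
    fact N / (\<Prod>i\<in>UNIV. fact (nat (m $ i))) * (\<Prod>i\<in>UNIV. (p $ i) powi (m $ i)) :: real)"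
  \<comment> \<open>With the remainder defined exactly, the claimed equation only needs
    \<open>pre N p \<noteq> 0\<close>; the work lies in the bound.\<close>
  define E where "E = (\<lambda>N p m. prob N p m * pre N p - (\<Sum>j<r. Q_coeff p (t N p m) j / real N ^ j))"
  have main: "prob N p m = 1 / pre N p * ((\<Sum>j<r. Q_coeff p (t N p m) j / real N ^ j) + E N p m) \<and>
      \<bar>E N p m\<bar> \<le> C / real N ^ r"
    if N: "N \<ge> N0" and pK: "p \<in> K" and sm: "(\<Sum>i\<in>UNIV. m $ i) = int N"
      and tB: "\<And>i. \<bar>t N p m $ i\<bar> \<le> B" for N p m
  proof -
    let ?t = "t N p m"
    have p: "p $ i > 0" "(\<Sum>i\<in>UNIV. p $ i) = 1" for i
      using pK assms(2) by (auto simp: open_simplex_def)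
    have N': "real N \<ge> (2 * B + 2) / \<delta> + 2 * B + 2" 
      using real_nat_ceiling_ge[of "(2 * B + 2) / \<delta> + 2 * B + 2"] N unfolding N0_def by linarith
    have "(2 * B + 2) / \<delta> \<ge> 0" using \<delta> assms by simp
    with N' assms(3) have N1: "real N \<ge> 2 * B + 2" "real N \<ge> (2 * B + 2) / \<delta>" "real N \<ge> 1" by auto
    have Np: "real N * p $ i \<ge> 2 * B + 2" "real N * p $ i \<ge> real N * \<delta>" for i
    proof -
      show "real N * p $ i \<ge> real N * \<delta>" using \<delta>(2)[OF pK, of i] by (intro mult_left_mono) auto
      moreover have "2 * B + 2 \<le> real N * \<delta>" using N1(2) \<delta>(1) by (simp add: field_simps)
      ultimately show "real N * p $ i \<ge> 2 * B + 2" by linarith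
    qed
    have ti: "real N * p $ i + ?t $ i = of_int (m $ i)" for i by (simp add: t_def)
    have "real_of_int (m $ i) \<ge> 0" for i using Np(1)[of i] tB[of i] ti[of i] assms(3) by linarith
    then have m0: "m $ i \<ge> 0" for i by simp
    then have mi: "real N * p $ i + ?t $ i = real (nat (m $ i))" for i by (simp add: ti)
    have "real_of_int (\<Sum>i\<in>UNIV. m $ i) = real N" by (simp add: sm)
    then have t0: "(\<Sum>i\<in>UNIV. ?t $ i) = 0"
      by (simp add: t_def sum_subtractf sum_distrib_left[symmetric] p)
    \<comment> \<open>\<open>R\<close> collects all Stirling errors, so that
      \<open>prob N p m * pre N p\<close> is exactly \<open>exp (q + R)\<close>.\<close>
    define R where "R = (ln (fact N) - stirling_approx r (real N) 1)
      - (\<Sum>i\<in>UNIV. ln (fact (nat (m $ i))) - stirling_approx r (real N * p $ i) (?t $ i + 1))"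
    define q where "q = (\<Sum>k=1..r. c_coeff p ?t k * (1 / real N) ^ k)"
    have pre_exp: "pre N p = exp ((real CARD('n) - 1) / 2 * ln (2 * pi * real N) + (\<Sum>i\<in>UNIV. ln (p $ i)) / 2)"
    proof -
      have pos: "(\<Prod>i\<in>UNIV. p $ i) > 0"
        using p(1) by (intro prod_pos) auto
      then have "sqrt (\<Prod>i\<in>UNIV. p $ i) = exp (ln (sqrt (\<Prod>i\<in>UNIV. p $ i)))"
        by simp
      also have "\<dots> = exp (ln (\<Prod>i\<in>UNIV. p $ i) / 2)"
        by (simp only: ln_sqrt[OF less_imp_le[OF pos]])
      also have "ln (\<Prod>i\<in>UNIV. p $ i) = (\<Sum>i\<in>UNIV. ln (p $ i))"
        using less_imp_neq[OF p(1), symmetric] by (intro ln_prod) simp_all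
      finally show ?thesis
        using N1 by (simp add: pre_def powr_def exp_add)
    qed
    have prob_exp: "prob N p m = exp (ln (fact N) - (\<Sum>i\<in>UNIV. ln (fact (nat (m $ i))))
        + (\<Sum>i\<in>UNIV. (real N * p $ i + ?t $ i) * ln (p $ i)))"
    proof -
      have "(p $ i) powi (m $ i) = exp ((real N * p $ i + ?t $ i) * ln (p $ i))" for i
        unfolding mi exp_of_nat_mult using p(1)[of i] m0[of i] by (simp add: power_int_def)
      then show ?thesis
        by (simp add: prob_def exp_add exp_diff exp_sum)
    qed
    have prod_exp: "prob N p m * pre N p = exp (q + R)"
      unfolding prob_exp pre_exp exp_add[symmetric]
      using stirling_approx_multinomial[of "real N" p ?t r] N1 p t0
      by (simp add: R_def q_def sum_subtractf)
    have Rb: "\<bar>R\<bar> \<le> C3 / real N ^ r"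
    proof -
      have 1: "\<bar>ln (fact N) - stirling_approx r (real N) 1\<bar> \<le> C1 / real N ^ r"
        using C1(2)[of 0 "real N" N] N1 assms by simp
      have "\<bar>ln (fact (nat (m $ i))) - stirling_approx r (real N * p $ i) (?t $ i + 1)\<bar>
          \<le> C1 / \<delta> ^ r / real N ^ r" for i
      proof -
        have "\<bar>ln (fact (nat (m $ i))) - stirling_approx r (real N * p $ i) (?t $ i + 1)\<bar>
            \<le> C1 / (real N * p $ i) ^ r"
          by (rule C1(2)[OF tB Np(1) mi])
        also have "\<dots> \<le> C1 / (real N * \<delta>) ^ r"
          using C1(1) Np(2)[of i] N1 \<delta>(1) by (intro frac_le power_mono) auto
        finally show ?thesis by (simp add: power_mult_distrib mult.commute)
      qed
      then have "\<bar>\<Sum>i\<in>UNIV. ln (fact (nat (m $ i))) - stirling_approx r (real N * p $ i) (?t $ i + 1)\<bar>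
          \<le> real CARD('n) * (C1 / \<delta> ^ r / real N ^ r)"
        by (intro order.trans[OF sum_abs sum_bounded_above])
      then show ?thesis using 1 unfolding R_def C3_def add_divide_distrib by simp
    qed
    \<comment> \<open>This crude bound confines \<open>R\<close> to an interval on which
      \<open>exp\<close> has Lipschitz constant \<open>exp C3\<close>; the sharper one supplies the
      rate.\<close>
    also have "\<dots> \<le> C3" using C3 N1 by (simp add: divide_le_eq mult_le_cancel_left1)
    finally have R3: "\<bar>R\<bar> \<le> C3" .
    have cM: "\<bar>c_coeff p ?t k\<bar> \<le> M" if "1 \<le> k" "k \<le> r" for k
      using \<delta>(2)[OF pK] tB that by (rule M(2))
    have qb: "q \<le> real r * M"
    proof -
      have "q \<le> (\<Sum>k=1..r. M * 1)"
        unfolding q_def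
      proof (rule sum_mono)
        fix k assume "k \<in> {1..r}"
        then have "\<bar>c_coeff p ?t k * (1 / real N) ^ k\<bar> \<le> M * 1"
          unfolding abs_mult using N1 M(1) cM[of k]
          by (intro mult_mono) (auto simp: power_divide)
        then show "c_coeff p ?t k * (1 / real N) ^ k \<le> M * 1" by linarith
      qed
      then show ?thesis by simp
    qed
    have expR: "\<bar>exp R - 1\<bar> \<le> exp C3 * \<bar>R\<bar>"
    proof -
      have "norm (exp R - exp 0) \<le> exp C3 * norm (R - 0)"
      proof (rule field_differentiable_bound[of "{-C3..C3}" exp exp])
        show "(exp has_field_derivative exp x) (at x within {-C3..C3})" for x :: real
          by (auto intro!: derivative_eq_intros)
      qed (use R3 C3 in auto)
      then show ?thesis by simp
    qed
    have Q: "\<bar>exp q - (\<Sum>j<r. Q_coeff p ?t j / real N ^ j)\<bar> \<le> C2 / real N ^ r"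
      using C2(2)[of "Q_coeff p ?t" "c_coeff p ?t" "1 / real N", OF Q_coeff_0 Q_coeff_Suc cM] N1
      by (simp add: q_def power_divide)
    have "\<bar>exp q * (exp R - 1)\<bar> \<le> exp (real r * M) * (exp C3 * (C3 / real N ^ r))"
      unfolding abs_mult using qb expR Rb
      by (intro mult_mono order.trans[OF expR] mult_left_mono) auto
    moreover have "E N p m = exp q * (exp R - 1) + (exp q - (\<Sum>j<r. Q_coeff p ?t j / real N ^ j))"
      unfolding E_def prod_exp by (simp add: exp_add right_diff_distrib)
    ultimately have "\<bar>E N p m\<bar> \<le> exp (real r * M) * (exp C3 * (C3 / real N ^ r)) + C2 / real N ^ r"
      using Q by linarith
    also have "\<dots> = C / real N ^ r" by (simp add: C_def add_divide_distrib)
    finally have "\<bar>E N p m\<bar> \<le> C / real N ^ r" .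
    moreover have "pre N p \<noteq> 0" by (simp add: pre_exp)
    then have "prob N p m = 1 / pre N p * ((\<Sum>j<r. Q_coeff p ?t j / real N ^ j) + E N p m)"
      by (simp add: E_def)
    ultimately show ?thesis by blast
  qed
  show ?thesis
    unfolding Let_def
  proof (intro exI[of _ E] exI[of _ C] exI[of _ N0] allI ballI impI)
    fix N p and m :: "int ^ 'n"
    assume "N \<ge> N0" "p \<in> K" and
      "(\<Sum>i\<in>UNIV. m $ i) = int N \<and> (\<forall>i. \<bar>(\<chi> i. of_int (m $ i) - real N * p $ i) $ i\<bar> \<le> B)"
    then have "prob N p m = 1 / pre N p * ((\<Sum>j<r. Q_coeff p (t N p m) j / real N ^ j) + E N p m) \<and>
        \<bar>E N p m\<bar> \<le> C / real N ^ r"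
      by (intro main) (simp_all add: t_def)
    then show "fact N / (\<Prod>i\<in>UNIV. fact (nat (m $ i))) * (\<Prod>i\<in>UNIV. (p $ i) powi (m $ i)) =
        1 / ((2 * pi * real N) powr ((real CARD('n) - 1) / 2) * sqrt (\<Prod>i\<in>UNIV. p $ i)) *
        ((\<Sum>j<r. Q_coeff p (\<chi> i. of_int (m $ i) - real N * p $ i) j / real N ^ j) + E N p m) \<and>
        \<bar>E N p m\<bar> \<le> C / real N ^ r"
      by (simp only: prob_def pre_def t_def)
  qed
qed

end
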